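(* Let $\lambda > 0$ and let $f$ be a real-valued function defined on $(0,\infty)$. Then the following are equivalent: (a) $f$ is a generalized Stieltjes function of order $\lambda$, i.e. there exist a constant $C \ge 0$ and a nonnegative (Borel) measure $\rho$ on $[0,\infty)$ such that $$ f(x) = C + \int_{[0,\infty)} \frac{d\rho(t)}{(x+t)^\lambda} \quad \text{for all } x>0, $$ with the integral convergent for all $x>0$. (b) $f$ is $C^\infty$ on $(0,\infty)$, and the quantities $$ F^{[\lambda]}_{n,k}(x) = (-1)^n \sum_{j=0}^k \binom{k}{j} \frac{\Gamma(n+k+\lambda)}{\Gamma(n+j+\lambda)}\, x^j f^{(n+j)}(x) = (-1)^n\, x^{-(n+\lambda-1)} D^k \big( x^{n+k+\lambda-1} D^n f(x)\big) $$ are nonnegative for all integers $n,k \ge 0$ and all $x>0$, where $D = d/dx$.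
   Context: $\Gamma$ denotes the Euler Gamma function; $f^{(m)}$ denotes the $m$-th derivative of $f$. For $\lambda = 1$, generalized Stieltjes functions of order $1$ are the Stieltjes functions. *)

theory Defs
  imports "HOL-Analysis.Analysis"
begin

definition gen_stieltjes :: "real \<Rightarrow> (real \<Rightarrow> real) \<Rightarrow> bool" where
  "gen_stieltjes lam f \<longleftrightarrow>
     (\<exists>C::real. \<exists>\<rho>::real measure.
        C \<ge> 0 \<and> sets \<rho> = sets borel \<and> emeasure \<rho> {..<0} = 0 \<and>
        (\<forall>x>0. set_integrable \<rho> {0..} (\<lambda>t. 1 / (x + t) powr lam) \<and>
               f x = C + (LINT t:{0..}|\<rho>. 1 / (x + t) powr lam)))"

definition smooth_pos :: "(real \<Rightarrow> real) \<Rightarrow> bool" where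
  "smooth_pos f \<longleftrightarrow> (\<forall>n. \<forall>x>0. ((deriv ^^ n) f) differentiable (at x))"

definition F_lam :: "real \<Rightarrow> (real \<Rightarrow> real) \<Rightarrow> nat \<Rightarrow> nat \<Rightarrow> real \<Rightarrow> real" where
  "F_lam lam f n k x = (-1) ^ n * (\<Sum>j=0..k. real (k choose j) *
      (Gamma (real (n + k) + lam) / Gamma (real (n + j) + lam)) * x ^ j * (deriv ^^ (n + j)) f x)"

end

theory Submission
  imports Defs "HOL-Probability.Probability" "HOL-Real_Asymp.Real_Asymp"
begin

text \<open>Substituting \<open>r = 1 / (1 + t)\<close> turns the kernel \<open>1 / (x + t) powr lam\<close>, up to a factor absorbed by
  the measure, into \<open>1 / (1 - (1 - x) r) powr lam\<close> with \<open>r\<close> in \<open>{0..1}\<close>. Hence the Taylor coefficients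
  at 1 of a generalized Stieltjes function are, up to binomial factors, the moments of a finite measure on
  \<open>{0..1}\<close>, and the nonnegativity of the \<open>F_lam lam f n k 1\<close> is exactly Hausdorff's condition on these
  moments. Given (b), Hausdorff's theorem therefore yields a generalized Stieltjes function with the
  same derivatives at 1 as \<open>f\<close>. Both functions are completely monotone, so their Taylor series at \<open>c\<close>
  converge to them on \<open>{c / 2<..<2 * c}\<close>, and they coincide by continuation along a geometric progression.\<close>

section \<open>The Hausdorff moment problem\<close>

fun moment_diff :: "(nat \<Rightarrow> real) \<Rightarrow> nat \<Rightarrow> nat \<Rightarrow> real" where
  "moment_diff m 0 n = m n"
| "moment_diff m (Suc k) n = moment_diff m k n - moment_diff m k (Suc n)"

lemma moment_diff_shift: "moment_diff (\<lambda>i. m (i + d)) k n = moment_diff m k (n + d)"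
  by (induction k arbitrary: n) auto

lemma moment_diff_scale: "moment_diff (\<lambda>i. c * m i) k n = c * moment_diff m k n"
  by (induction k arbitrary: n) (auto simp: algebra_simps)

lemma moment_diff_eq_sum:
  "moment_diff m k n = (\<Sum>j\<le>k. (-1) ^ j * real (k choose j) * m (n + j))"
proof (induction k arbitrary: n)
  case (Suc k)
  have "(\<Sum>j\<le>Suc k. (-1) ^ j * real (Suc k choose j) * m (n + j))
      = m n + (\<Sum>j\<le>k. (-1) ^ Suc j * real (Suc k choose Suc j) * m (n + Suc j))"
    by (subst sum.atMost_Suc_shift) simp
  also have "\<dots> = (m n + (\<Sum>j\<le>k. (-1) ^ Suc j * real (k choose Suc j) * m (n + Suc j)))
      - (\<Sum>j\<le>k. (-1) ^ j * real (k choose j) * m (Suc n + j))"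
    by (simp add: sum.distrib sum_negf sum_subtractf algebra_simps)
  also have "m n + (\<Sum>j\<le>k. (-1) ^ Suc j * real (k choose Suc j) * m (n + Suc j))
      = (\<Sum>j\<le>Suc k. (-1) ^ j * real (k choose j) * m (n + j))"
    by (subst sum.atMost_Suc_shift) simp
  also have "\<dots> = (\<Sum>j\<le>k. (-1) ^ j * real (k choose j) * m (n + j))"
    by simp
  finally show ?case
    by (simp only: Suc moment_diff.simps)
qed simp

text \<open>For moments this is the integral of \<open>(r + (1 - r)) ^ N = 1\<close>. Pascal's rule
  splits each coefficient, and the halves recombine termwise by \<open>moment_diff m (Suc j) k +
  moment_diff m j (Suc k) = moment_diff m j k\<close>.\<close>

lemma sum_binomial_moment_diff:
  "(\<Sum>k\<le>N. real (N choose k) * moment_diff m (N - k) k) = m 0"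
proof (induction N)
  case (Suc N)
  have "(\<Sum>k\<le>Suc N. real (Suc N choose k) * moment_diff m (Suc N - k) k)
      = moment_diff m (Suc N) 0 + (\<Sum>k\<le>N. real (Suc N choose Suc k) * moment_diff m (N - k) (Suc k))"
    by (subst sum.atMost_Suc_shift) simp
  also have "\<dots> = (moment_diff m (Suc N) 0 + (\<Sum>k\<le>N. real (N choose Suc k) * moment_diff m (N - k) (Suc k)))
      + (\<Sum>k\<le>N. real (N choose k) * moment_diff m (N - k) (Suc k))"
    by (simp add: sum.distrib algebra_simps)
  also have "moment_diff m (Suc N) 0 + (\<Sum>k\<le>N. real (N choose Suc k) * moment_diff m (N - k) (Suc k))
      = (\<Sum>k\<le>Suc N. real (N choose k) * moment_diff m (Suc N - k) k)"
    by (subst sum.atMost_Suc_shift) simp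
  also have "\<dots> = (\<Sum>k\<le>N. real (N choose k) * moment_diff m (Suc (N - k)) k)"
    by (simp add: Suc_diff_le)
  also have "\<dots> + (\<Sum>k\<le>N. real (N choose k) * moment_diff m (N - k) (Suc k))
      = (\<Sum>k\<le>N. real (N choose k) * moment_diff m (N - k) k)"
    by (simp add: sum.distrib[symmetric] algebra_simps)
  finally show ?case
    using Suc by simp
qed simp

text \<open>Regrouping \<open>(N choose k) * (k choose n)\<close> as
  \<open>(N choose n) * ((N - n) choose (k - n))\<close> leaves the total weight for the sequence
  shifted by \<open>n\<close>. The result is the exact \<open>n\<close>-th binomial moment of the
  weights used below.\<close>

lemma sum_choose_binomial_moment_diff:
  assumes "n \<le> N"
  shows "(\<Sum>k\<le>N. real (k choose n) * (real (N choose k) * moment_diff m (N - k) k))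
      = real (N choose n) * m n"
proof -
  have "(\<Sum>k\<le>N. real (k choose n) * (real (N choose k) * moment_diff m (N - k) k))
      = (\<Sum>k\<in>{n..N}. real (k choose n) * (real (N choose k) * moment_diff m (N - k) k))"
    by (rule sum.mono_neutral_right) auto
  also have "\<dots> = (\<Sum>k\<in>{n..N}. real (N choose n) *
      (real ((N - n) choose (k - n)) * moment_diff m (N - k) k))"
  proof (rule sum.cong)
    fix k assume "k \<in> {n..N}"
    then have "real (N choose k) * real (k choose n) = real (N choose n) * real ((N - n) choose (k - n))"
      using choose_mult[of n k N] by (simp flip: of_nat_mult)
    then show "real (k choose n) * (real (N choose k) * moment_diff m (N - k) k)
        = real (N choose n) * (real ((N - n) choose (k - n)) * moment_diff m (N - k) k)"
      by (metis mult.assoc mult.commute)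
  qed simp
  also have "\<dots> = (\<Sum>j\<le>N - n. real (N choose n) *
      (real ((N - n) choose j) * moment_diff m (N - n - j) (j + n)))"
    using assms
    by (intro sum.reindex_bij_witness[where i = "\<lambda>j. j + n" and j = "\<lambda>k. k - n"]) auto
  also have "\<dots> = real (N choose n) *
      (\<Sum>j\<le>N - n. real ((N - n) choose j) * moment_diff (\<lambda>i. m (i + n)) (N - n - j) j)"
    by (simp add: sum_distrib_left moment_diff_shift)
  finally show ?thesis
    by (simp only: sum_binomial_moment_diff) simp
qed

text \<open>The quotient of binomials is a product of \<open>n\<close> factors close to
  \<open>k / N\<close>, and products of factors of absolute value at most 1 differ by at most the
  sum of the differences of their factors. This allows binomial moments to replace ordinary ones for
  large \<open>N\<close>.\<close>

lemma binomial_ratio_approx: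
  fixes n N k :: nat
  assumes "2 * n < N" "k \<le> N"
  shows "\<bar>(real k / real N) ^ n - real (k choose n) / real (N choose n)\<bar> \<le> real n * (real n / (real N - real n))"
proof -
  have fact_ratio: "real (k choose n) / real (N choose n) = (\<Prod>i<n. (real k - real i) / (real N - real i))"
    by (simp add: binomial_gbinomial gbinomial_prod_rev prod_dividef atLeast0LessThan)
  have diff: "\<bar>real k / real N - (real k - real i) / (real N - real i)\<bar> \<le> real n / (real N - real n)"
    if "i < n" for i
  proof -
    have pos: "real N > 0" "real N - real i > 0" "real N - real n > 0"
      using assms that by auto
    have "real k / real N - (real k - real i) / (real N - real i)
        = real i * ((real N - real k) / real N) / (real N - real i)"
      using pos by (simp add: field_simps)
    moreover have "real i * ((real N - real k) / real N) \<le> real n * 1"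
      using assms that pos by (intro mult_mono) auto
    then have "real i * ((real N - real k) / real N) / (real N - real i) \<le> real n / (real N - real n)"
      using assms that pos by (intro frac_le) auto
    moreover have "real i * ((real N - real k) / real N) / (real N - real i) \<ge> 0"
      using assms pos by auto
    ultimately show ?thesis
      by (metis abs_of_nonneg)
  qed
  \<comment> \<open>Factors with \<open>k < i\<close> are negative; \<open>2 * n < N\<close> then
    gives \<open>i - k \<le> i < N - i\<close>.\<close>
  have factor: "\<bar>(real k - real i) / (real N - real i)\<bar> \<le> 1" if "i < n" for i
    using assms that by (auto simp: abs_le_iff field_simps)
  have "norm ((\<Prod>i<n. real k / real N) - (\<Prod>i<n. (real k - real i) / (real N - real i)))
      \<le> (\<Sum>i<n. norm (real k / real N - (real k - real i) / (real N - real i)))"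
    using factor assms by (intro norm_prod_diff) (auto simp: divide_le_eq_1)
  also have "\<dots> \<le> (\<Sum>i<n. real n / (real N - real n))"
    using diff by (intro sum_mono) auto
  finally show ?thesis
    by (simp add: fact_ratio)
qed

text \<open>The weights \<open>q N k\<close>, placed at the points \<open>k / N\<close>, form
  probability measures on the unit interval whose \<open>n\<close>-th moments tend to
  \<open>m n\<close>. By tightness a subsequence converges weakly, and its limit yields the measure
  sought.\<close>

lemma hausdorff_moment_normalized:
  fixes m :: "nat \<Rightarrow> real"
  assumes nonneg: "\<And>k n. moment_diff m k n \<ge> 0" and m0: "m 0 = 1"
  obtains \<nu> where "real_distribution \<nu>" "AE x in \<nu>. x \<in> {0..1}" "\<And>n. (LINT x|\<nu>. x ^ n) = m n"
proof -
  define q where "q N k = (if k \<le> N then real (N choose k) * moment_diff m (N - k) k else 0)" for N k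
  have q_nonneg: "q N k \<ge> 0" for N k
    using nonneg by (simp add: q_def)
  have q_sum: "(\<Sum>k\<le>N. q N k) = 1" for N
    using sum_binomial_moment_diff[of N m] m0 by (simp add: q_def)
  define p where "p N = embed_pmf (q N)" for N
  have nn1: "(\<integral>\<^sup>+k. ennreal (q N k) \<partial>count_space UNIV) = 1" for N
  proof -
    have "(\<integral>\<^sup>+k. ennreal (q N k) \<partial>count_space UNIV) = (\<Sum>k\<le>N. ennreal (q N k))"
      by (rule nn_integral_count_space') (auto simp: q_def)
    then show ?thesis
      using q_nonneg by (simp add: q_sum)
  qed
  have pmf_p: "pmf (p N) k = q N k" for N k
    unfolding p_def by (rule pmf_embed_pmf[OF q_nonneg nn1])
  have supp: "k \<le> N" if "k \<in> set_pmf (p N)" for N k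
    using that by (auto simp: set_pmf_iff pmf_p q_def split: if_splits)
  define \<mu> where "\<mu> N = distr (measure_pmf (p N)) borel (\<lambda>k. real k / real N)" for N
  have rd: "real_distribution (\<mu> N)" for N
    unfolding \<mu>_def by (rule prob_space.real_distribution_distr) (auto intro: measure_pmf.prob_space_axioms)
  have unit: "real k / real N \<in> {0..1}" if "k \<in> set_pmf (p N)" for N k
    using supp[OF that] by (auto simp: divide_le_eq_1)
  \<comment> \<open>Tightness is stated with half-open intervals; the left end -1 keeps a possible
    atom at 0 inside.\<close>
  have "measure (\<mu> N) {-1<..1} = 1" for N
  proof -
    have "measure (\<mu> N) {-1<..1} = measure_pmf.prob (p N) {k. real k / real N \<in> {-1<..1}}"
      by (simp add: \<mu>_def measure_distr vimage_def)
    also have "\<dots> = 1"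
      by (subst measure_pmf.prob_eq_1) (use unit[of _ N] in \<open>auto simp: AE_measure_pmf_iff intro: less_le_trans[of _ 0]\<close>)
    finally show ?thesis .
  qed
  then have "tight \<mu>"
    unfolding tight_def using rd by (intro conjI allI impI exI[of _ "- 1 :: real"] exI[of _ "1 :: real"]) auto
  then obtain r M where r: "strict_mono r" and M: "real_distribution M" and wc: "weak_conv_m (\<mu> \<circ> r) M"
    using tight_imp_convergent_subsubsequence[of \<mu> id] by (auto simp: strict_mono_id)
  interpret M: real_distribution M by (rule M)
  \<comment> \<open>Weak convergence tests bounded continuous functions, so the powers are composed
    with this clamp, which is the identity on \<open>{0..1}\<close>. Pushing the limit forward along
    \<open>c\<close> at the end also confines it to the unit interval.\<close>
  define c where "c x = max 0 (min 1 x)" for x :: real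
  have c_cont: "isCont c x" for x
    unfolding c_def by (intro continuous_intros)
  have [measurable]: "c \<in> borel_measurable borel"
    unfolding c_def by measurable
  have c_unit: "c x \<in> {0..1}" for x
    by (auto simp: c_def)
  have c_frac: "c (real k / real N) = real k / real N" if "k \<le> N" for k N
  proof -
    have "real k / real N \<le> 1"
      using that by (auto simp: divide_le_eq_1)
    then show ?thesis
      by (simp add: c_def)
  qed
  have moment: "(LINT x|\<mu> N. c x ^ n) = (\<Sum>k\<le>N. (real k / real N) ^ n * q N k)" for N n
  proof -
    have "(LINT x|\<mu> N. c x ^ n) = (LINT k|measure_pmf (p N). c (real k / real N) ^ n)"
      by (simp add: \<mu>_def integral_distr)
    also have "\<dots> = (\<Sum>k\<le>N. c (real k / real N) ^ n * pmf (p N) k)"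
      by (rule integral_measure_pmf_real) (auto dest: supp)
    also have "\<dots> = (\<Sum>k\<le>N. (real k / real N) ^ n * q N k)"
      by (intro sum.cong) (auto simp: pmf_p c_frac)
    finally show ?thesis .
  qed
  have lim1: "(\<lambda>N. LINT x|\<mu> N. c x ^ n) \<longlonglongrightarrow> m n" for n
  proof (rule LIM_zero_cancel, rule Lim_null_comparison)
    show "(\<lambda>N. real n * (real n / (real N - real n))) \<longlonglongrightarrow> 0"
      by real_asymp
    show "\<forall>\<^sub>F N in sequentially. norm ((LINT x|\<mu> N. c x ^ n) - m n) \<le> real n * (real n / (real N - real n))"
      using eventually_gt_at_top[of "2 * n"]
    proof eventually_elim
      case (elim N)
      \<comment> \<open>The exact binomial moment writes \<open>m n\<close> as an average over the
        same weights as the integral, so only the pointwise error of the binomial quotient has to be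
        estimated.\<close>
      have "(\<Sum>k\<le>N. real (k choose n) * q N k) = real (N choose n) * m n"
        using elim sum_choose_binomial_moment_diff[of n N m] by (simp add: q_def)
      then have "m n = (\<Sum>k\<le>N. real (k choose n) / real (N choose n) * q N k)"
        using elim by (simp add: sum_divide_distrib[symmetric] divide_simps)
      then have "norm ((LINT x|\<mu> N. c x ^ n) - m n)
          = \<bar>\<Sum>k\<le>N. ((real k / real N) ^ n - real (k choose n) / real (N choose n)) * q N k\<bar>"
        by (simp add: moment sum_subtractf left_diff_distrib)
      also have "\<dots> \<le> (\<Sum>k\<le>N. \<bar>((real k / real N) ^ n - real (k choose n) / real (N choose n)) * q N k\<bar>)"
        by (rule sum_abs)
      also have "\<dots> \<le> (\<Sum>k\<le>N. real n * (real n / (real N - real n)) * q N k)"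
      proof (rule sum_mono)
        fix k assume "k \<in> {..N}"
        then show "\<bar>((real k / real N) ^ n - real (k choose n) / real (N choose n)) * q N k\<bar>
            \<le> real n * (real n / (real N - real n)) * q N k"
          using mult_right_mono[OF binomial_ratio_approx[OF elim, of k] q_nonneg[of N k]] q_nonneg[of N k]
          by (simp add: abs_mult)
      qed
      also have "\<dots> = real n * (real n / (real N - real n))"
        by (simp only: sum_distrib_left[symmetric] q_sum mult_1_right)
      finally show ?case .
    qed
  qed
  have lim2: "(\<lambda>i. LINT x|(\<mu> \<circ> r) i. c x ^ n) \<longlonglongrightarrow> (LINT x|M. c x ^ n)" for n
  proof (rule weak_conv_imp_integral_bdd_continuous_conv[OF _ M wc, where B = 1])
    show "real_distribution ((\<mu> \<circ> r) i)" for i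
      by (simp add: rd)
    show "isCont (\<lambda>x. c x ^ n) x" for x
      using c_cont by (intro continuous_intros)
    show "norm (c x ^ n) \<le> 1" for x
      using c_unit[of x] by (auto intro!: power_le_one)
  qed
  have "(LINT x|M. c x ^ n) = m n" for n
    using LIMSEQ_unique[OF lim2] LIMSEQ_subseq_LIMSEQ[OF lim1[of n] r] by (simp add: comp_def)
  then have "(LINT x|distr M borel c. x ^ n) = m n" for n
    by (simp add: integral_distr)
  moreover have "real_distribution (distr M borel c)"
    by (intro M.real_distribution_distr) simp
  moreover have "AE x in distr M borel c. x \<in> {0..1}"
    using c_unit by (subst AE_distr_iff) auto
  ultimately show thesis
    using that by blast
qed

text \<open>Dividing by \<open>m 0\<close> reduces to the normalized case. If
  \<open>m 0 = 0\<close>, the sequence is nonnegative and nonincreasing, hence zero, and the null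
  measure serves.\<close>

theorem hausdorff_moment:
  fixes m :: "nat \<Rightarrow> real"
  assumes nonneg: "\<And>k n. moment_diff m k n \<ge> 0"
  obtains \<nu> where "sets \<nu> = sets borel" "finite_measure \<nu>" "AE x in \<nu>. x \<in> {0..1}"
    "\<And>n. (LINT x|\<nu>. x ^ n) = m n"
proof (cases "m 0 = 0")
  case True
  have "m n \<ge> 0" "m (Suc n) \<le> m n" for n
    using nonneg[of 0 n] nonneg[of 1 n] by auto
  then have "m n = 0" for n
    by (induction n) (use True in simp, metis order.antisym)
  then show thesis
    by (intro that[of "null_measure borel"]) (auto intro!: finite_measureI simp: AE_iff_null)
next
  case False
  then have pos: "m 0 > 0"
    using nonneg[of 0 0] by simp
  have "moment_diff (\<lambda>i. 1 / m 0 * m i) k n \<ge> 0" for k n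
    unfolding moment_diff_scale using nonneg pos by simp
  then obtain \<nu> where \<nu>: "real_distribution \<nu>" "AE x in \<nu>. x \<in> {0..1}"
      and mom: "\<And>n. (LINT x|\<nu>. x ^ n) = 1 / m 0 * m n"
    using hausdorff_moment_normalized[of "\<lambda>i. 1 / m 0 * m i"] False by auto
  interpret \<nu>: real_distribution \<nu> by fact
  show thesis
  proof (rule that[of "density \<nu> (\<lambda>_. m 0)"])
    show "finite_measure (density \<nu> (\<lambda>_. m 0))"
      by (rule finite_measureI) (simp add: emeasure_density ennreal_mult_eq_top_iff)
    show "AE x in density \<nu> (\<lambda>_. m 0). x \<in> {0..1}"
      using \<nu>(2) by (subst AE_density) auto
    show "(LINT x|density \<nu> (\<lambda>_. m 0). x ^ n) = m n" for n
      using pos by (subst integral_density) (auto simp: mom)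
  qed simp
qed

section \<open>Completely monotone functions\<close>

lemma smooth_pos_has_derivative:
  assumes "smooth_pos f" "x > 0"
  shows "((deriv ^^ n) f has_real_derivative (deriv ^^ Suc n) f x) (at x)"
  using assms by (simp add: smooth_pos_def DERIV_deriv_iff_real_differentiable)

text \<open>The half-line is open, so a derivative at one of its points depends only on values
  there, and agreement with \<open>D n\<close> passes from each order to the next.\<close>

lemma smooth_posI:
  fixes D :: "nat \<Rightarrow> real \<Rightarrow> real"
  assumes D: "\<And>n x. x > 0 \<Longrightarrow> (D n has_real_derivative D (Suc n) x) (at x)"
    and f: "\<And>x. x > 0 \<Longrightarrow> f x = D 0 x"
  shows "smooth_pos f" and "x > 0 \<Longrightarrow> (deriv ^^ n) f x = D n x"
proof -
  have step: "((deriv ^^ n) f has_real_derivative D (Suc n) x) (at x)"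
    if "x > 0" "\<And>y. y > 0 \<Longrightarrow> (deriv ^^ n) f y = D n y" for n x
    using D[OF that(1)]
    by (rule has_field_derivative_transform_within_open[of _ _ _ "{0<..}"]) (use that in auto)
  have eq: "(deriv ^^ n) f x = D n x" if "x > 0" for n x
    using that
  proof (induction n arbitrary: x)
    case (Suc n)
    then show ?case
      using step[of x n] by (simp add: DERIV_imp_deriv)
  qed (simp add: f)
  then show "x > 0 \<Longrightarrow> (deriv ^^ n) f x = D n x" .
  show "smooth_pos f"
    unfolding smooth_pos_def using step[OF _ eq] real_differentiable_def by blast
qed

definition completely_monotone :: "(real \<Rightarrow> real) \<Rightarrow> bool" where
  "completely_monotone f \<longleftrightarrow> smooth_pos f \<and> (\<forall>n. \<forall>x>0. (-1) ^ n * (deriv ^^ n) f x \<ge> 0)"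

section \<open>Taylor expansion of completely monotone functions\<close>

lemma completely_monotone_abs_deriv:
  assumes "completely_monotone f" "x > 0"
  shows "\<bar>(deriv ^^ n) f x\<bar> = (-1) ^ n * (deriv ^^ n) f x"
proof -
  have "0 \<le> (-1) ^ n * (deriv ^^ n) f x"
    using assms by (simp add: completely_monotone_def)
  from abs_of_nonneg[OF this] show ?thesis
    by (simp add: abs_mult power_abs)
qed

text \<open>The absolute value of the \<open>n\<close>-th derivative is
  \<open>(-1) ^ n * (deriv ^^ n) f\<close>, whose derivative is minus the corresponding nonnegative
  quantity of order \<open>Suc n\<close>.\<close>

lemma completely_monotone_antimono_abs:
  assumes "completely_monotone f" "0 < p" "p \<le> \<xi>"
  shows "\<bar>(deriv ^^ n) f \<xi>\<bar> \<le> \<bar>(deriv ^^ n) f p\<bar>"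
proof -
  have "(-1) ^ n * (deriv ^^ n) f \<xi> \<le> (-1) ^ n * (deriv ^^ n) f p"
  proof (rule DERIV_nonpos_imp_nonincreasing[OF assms(3)], intro exI conjI)
    fix x assume "p \<le> x"
    then have "x > 0"
      using assms(2) by simp
    show "((\<lambda>x. (-1) ^ n * (deriv ^^ n) f x) has_real_derivative (-1) ^ n * (deriv ^^ Suc n) f x) (at x)"
      using assms(1) \<open>x > 0\<close> unfolding completely_monotone_def
      by (intro DERIV_cmult smooth_pos_has_derivative) auto
    show "(-1) ^ n * (deriv ^^ Suc n) f x \<le> 0"
      using completely_monotone_abs_deriv[OF assms(1) \<open>x > 0\<close>, of "Suc n"] by simp
  qed
  then show ?thesis
    using completely_monotone_abs_deriv[OF assms(1)] assms(2,3) by simp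
qed

text \<open>Lagrange's remainder, for \<open>x\<close> on either side of \<open>c\<close>. Only a
  lower bound on \<open>t\<close> is kept, because the absolute values of the derivatives decrease
  to the right.\<close>

lemma completely_monotone_Taylor:
  assumes "completely_monotone f" "c > 0" "x > 0" "x \<noteq> c" "n > 0"
  obtains t where "min x c < t"
    "(deriv ^^ m) f x = (\<Sum>i<n. (deriv ^^ (i + m)) f c / fact i * (x - c) ^ i)
      + (deriv ^^ (n + m)) f t / fact n * (x - c) ^ n"
proof -
  have "((deriv ^^ (i + m)) f has_real_derivative (deriv ^^ (Suc i + m)) f t) (at t)"
    if "min x c \<le> t" for i t
    using smooth_pos_has_derivative[of f t "i + m"] assms(1-3) that
    by (simp add: completely_monotone_def min_le_iff_disj del: funpow.simps) argo
  then have "\<forall>i t. i < n \<and> min x c \<le> t \<and> t \<le> max x c \<longrightarrow>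
      ((deriv ^^ (i + m)) f has_real_derivative (deriv ^^ (Suc i + m)) f t) (at t)"
    by blast
  from Taylor[OF assms(5) _ this, of "(deriv ^^ m) f" c x] assms(4)
  show thesis
    by (auto split: if_splits intro!: that)
qed

text \<open>In the expansion at \<open>p\<close> evaluated to the left, at \<open>p - d\<close>, the
  alternating signs of the derivatives cancel those of the powers of \<open>- d\<close>. All terms
  and the remainder thus share one sign, and a single term is bounded by the whole.\<close>

lemma completely_monotone_Taylor_coeff_bound:
  assumes cm: "completely_monotone f" and "0 < d" "d < p"
  shows "\<bar>(deriv ^^ (n + m)) f p\<bar> / fact n * d ^ n \<le> \<bar>(deriv ^^ m) f (p - d)\<bar>"
proof -
  note abs_eq = completely_monotone_abs_deriv[OF cm]
  obtain t where t: "min (p - d) p < t"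
    and eq: "(deriv ^^ m) f (p - d) = (\<Sum>i<Suc n. (deriv ^^ (i + m)) f p / fact i * (p - d - p) ^ i)
      + (deriv ^^ (Suc n + m)) f t / fact (Suc n) * (p - d - p) ^ Suc n"
    using completely_monotone_Taylor[OF cm, of p "p - d" "Suc n" m] assms by auto
  have t_pos: "t > 0" and p_pos: "p > 0"
    using t assms by auto
  have sign: "(-1) ^ m * ((deriv ^^ (i + m)) f y / fact i * (p - d - p) ^ i)
      = \<bar>(deriv ^^ (i + m)) f y\<bar> / fact i * d ^ i" if "y > 0" for y i
  proof -
    have "(p - d - p) ^ i = (-1) ^ i * d ^ i"
      by (simp add: power_minus[of d])
    then show ?thesis
      by (simp add: abs_eq[OF that] power_add)
  qed
  have "\<bar>(deriv ^^ (n + m)) f p\<bar> / fact n * d ^ n \<le> (\<Sum>i<Suc n. \<bar>(deriv ^^ (i + m)) f p\<bar> / fact i * d ^ i)"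
    using assms by (intro member_le_sum) auto
  also have "\<dots> \<le> \<dots> + \<bar>(deriv ^^ (Suc n + m)) f t\<bar> / fact (Suc n) * d ^ Suc n"
    using assms by (simp del: sum.lessThan_Suc funpow.simps)
  also have "\<dots> = (-1) ^ m * (deriv ^^ m) f (p - d)"
    by (simp only: eq distrib_left sum_distrib_left sign[OF p_pos] sign[OF t_pos])
  also have "\<dots> = \<bar>(deriv ^^ m) f (p - d)\<bar>"
    using abs_eq[of "p - d" m] assms by simp
  finally show ?thesis .
qed

text \<open>The hypothesis says that \<open>x\<close> lies in \<open>{c / 2<..<2 * c}\<close>. The
  derivative in the remainder is bounded by its value at \<open>p = min x c\<close>, and the
  coefficient bound at \<open>p\<close> makes the remainder geometrically small.\<close>

lemma completely_monotone_Taylor_sums: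
  assumes cm: "completely_monotone f" and "c > 0" "\<bar>x - c\<bar> < min x c"
  shows "(\<lambda>n. (deriv ^^ (n + m)) f c / fact n * (x - c) ^ n) sums (deriv ^^ m) f x"
proof (cases "x = c")
  case True
  then show ?thesis
    using powser_sums_zero[of "\<lambda>n. (deriv ^^ (n + m)) f c / fact n"] by simp
next
  case False
  define p where "p = min x c"
  \<comment> \<open>A midpoint: \<open>\<bar>x - c\<bar> < d\<close> makes the ratio less than 1,
    and \<open>d < p\<close> keeps \<open>p - d\<close> positive.\<close>
  define d where "d = (\<bar>x - c\<bar> + p) / 2"
  define B where "B = \<bar>(deriv ^^ m) f (p - d)\<bar>"
  have p: "p > 0" and d: "0 < d" "d < p" "\<bar>x - c\<bar> < d"
    using assms(2,3) False by (auto simp: p_def d_def)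
  show ?thesis
    unfolding sums_def
  proof (rule LIM_zero_cancel, rule Lim_null_comparison)
    have "(\<lambda>n. (\<bar>x - c\<bar> / d) ^ n) \<longlonglongrightarrow> 0"
      using d by (intro LIMSEQ_power_zero) auto
    then show "(\<lambda>n. B * (\<bar>x - c\<bar> / d) ^ n) \<longlonglongrightarrow> 0"
      by (rule tendsto_mult_right_zero)
    show "\<forall>\<^sub>F n in sequentially. norm ((\<Sum>i<n. (deriv ^^ (i + m)) f c / fact i * (x - c) ^ i) - (deriv ^^ m) f x)
        \<le> B * (\<bar>x - c\<bar> / d) ^ n"
      using eventually_gt_at_top[of 0]
    proof eventually_elim
      case (elim n)
      obtain t where t: "p < t"
        and eq: "(deriv ^^ m) f x = (\<Sum>i<n. (deriv ^^ (i + m)) f c / fact i * (x - c) ^ i)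
          + (deriv ^^ (n + m)) f t / fact n * (x - c) ^ n"
        using completely_monotone_Taylor[OF cm \<open>c > 0\<close> _ False elim, of m] p unfolding p_def by auto
      have "norm ((\<Sum>i<n. (deriv ^^ (i + m)) f c / fact i * (x - c) ^ i) - (deriv ^^ m) f x)
          = \<bar>(deriv ^^ (n + m)) f t\<bar> / fact n * \<bar>x - c\<bar> ^ n"
        unfolding eq by (simp add: abs_mult power_abs)
      also have "\<dots> \<le> \<bar>(deriv ^^ (n + m)) f p\<bar> / fact n * \<bar>x - c\<bar> ^ n"
        using completely_monotone_antimono_abs[OF cm p, of t "n + m"] t
        by (intro mult_right_mono divide_right_mono) auto
      also have "\<dots> = \<bar>(deriv ^^ (n + m)) f p\<bar> / fact n * d ^ n * (\<bar>x - c\<bar> / d) ^ n"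
        using d by (simp add: power_divide)
      also have "\<dots> \<le> B * (\<bar>x - c\<bar> / d) ^ n"
        unfolding B_def using d
        by (intro mult_right_mono completely_monotone_Taylor_coeff_bound[OF cm]) auto
      finally show ?case .
    qed
  qed
qed

theorem completely_monotone_eqI:
  assumes cm: "completely_monotone f" "completely_monotone g" and "c > 0"
    and eq: "\<And>n. (deriv ^^ n) f c = (deriv ^^ n) g c" and "x > 0"
  shows "f x = g x"
proof -
  \<comment> \<open>With \<open>k\<close> above the absolute binary logarithm of
    \<open>x / c\<close>, the \<open>k\<close>-th root \<open>r\<close> of \<open>x / c\<close> lies
    strictly between 1/2 and 2, so each step from \<open>c * r ^ j\<close> to
    \<open>c * r ^ Suc j\<close> stays within reach of the Taylor series.\<close>
  obtain k :: nat where k: "\<bar>ln (x / c)\<bar> / ln 2 < real k"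
    using reals_Archimedean2 by blast
  moreover have "0 \<le> \<bar>ln (x / c)\<bar> / ln 2"
    by simp
  ultimately have k_pos: "k > 0"
    by linarith
  define r where "r = exp (ln (x / c) / real k)"
  have "\<bar>ln (x / c) / real k\<bar> < ln 2"
    using k k_pos by (simp add: field_simps)
  then have "- ln 2 < ln (x / c) / real k" "ln (x / c) / real k < ln 2"
    by linarith+
  then have "exp (- ln 2) < r" "r < exp (ln 2)"
    unfolding r_def by (simp_all only: exp_less_cancel_iff)
  then have r: "1 / 2 < r" "r < 2"
    by (simp_all add: exp_minus)
  have "r ^ k = x / c"
    using k_pos assms by (simp add: r_def exp_of_nat_mult[symmetric])
  then have x_eq: "x = c * r ^ k"
    using \<open>c > 0\<close> by simp
  \<comment> \<open>Derivatives of all orders are carried along, since the next expansion uses every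
    one of them.\<close>
  have "\<forall>n. (deriv ^^ n) f (c * r ^ j) = (deriv ^^ n) g (c * r ^ j)" for j
  proof (induction j)
    case (Suc j)
    define b where "b = c * r ^ j"
    have b: "b > 0" "c * r ^ Suc j = r * b"
      using r \<open>c > 0\<close> by (auto simp: b_def)
    have "r * b < 2 * b" "1 / 2 * b < r * b"
      by (intro mult_strict_right_mono r b(1))+
    then have near: "\<bar>r * b - b\<bar> < min (r * b) b"
      unfolding min_less_iff_conj by (intro conjI; linarith)
    show ?case
    proof
      fix n
      have "(\<lambda>i. (deriv ^^ (i + n)) f b / fact i * (r * b - b) ^ i) sums (deriv ^^ n) f (r * b)"
        "(\<lambda>i. (deriv ^^ (i + n)) g b / fact i * (r * b - b) ^ i) sums (deriv ^^ n) g (r * b)"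
        by (rule completely_monotone_Taylor_sums[OF cm(1) b(1) near]
          completely_monotone_Taylor_sums[OF cm(2) b(1) near])+
      then show "(deriv ^^ n) f (c * r ^ Suc j) = (deriv ^^ n) g (c * r ^ Suc j)"
        using Suc unfolding b(2) b_def[symmetric] by (simp add: sums_unique2)
    qed
  qed (simp add: eq)
  from this[of k] show ?thesis
    by (metis funpow_0 x_eq)
qed

section \<open>Stieltjes integrals\<close>

text \<open>Dominated convergence applied to the difference quotients along an arbitrary sequence
  tending to \<open>x\<close>; the mean value inequality on the ball bounds them by
  \<open>w t\<close>.\<close>

lemma has_real_derivative_integral:
  fixes k k' :: "real \<Rightarrow> 'a \<Rightarrow> real"
  assumes "d > 0"
    and deriv: "\<And>y t. \<bar>y - x\<bar> < d \<Longrightarrow> ((\<lambda>y. k y t) has_real_derivative k' y t) (at y)"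
    and bound: "\<And>y t. \<bar>y - x\<bar> < d \<Longrightarrow> \<bar>k' y t\<bar> \<le> w t"
    and w: "integrable M w"
    and k: "\<And>y. \<bar>y - x\<bar> < d \<Longrightarrow> integrable M (k y)"
    and k' [measurable]: "k' x \<in> borel_measurable M"
  shows "((\<lambda>y. LINT t|M. k y t) has_real_derivative (LINT t|M. k' x t)) (at x)"
proof -
  have "((\<lambda>y. ((LINT t|M. k y t) - (LINT t|M. k x t)) / (y - x)) \<longlongrightarrow> (LINT t|M. k' x t)) (at x within ball x d)"
    unfolding tendsto_at_iff_sequentially comp_def
  proof (intro allI impI)
    fix X :: "nat \<Rightarrow> real"
    assume X: "\<forall>i. X i \<in> ball x d - {x}" and lim: "X \<longlonglongrightarrow> x"
    have X': "\<bar>X i - x\<bar> < d" "X i \<noteq> x" for i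
      using X[rule_format, of i] by (auto simp: dist_real_def)
    have x: "\<bar>x - x\<bar> < d"
      using \<open>d > 0\<close> by simp
    have [measurable]: "k (X i) \<in> borel_measurable M" "k x \<in> borel_measurable M" for i
      using k[OF X'(1)] k[OF x] by auto
    have "(\<lambda>i. LINT t|M. (k (X i) t - k x t) / (X i - x)) \<longlonglongrightarrow> (LINT t|M. k' x t)"
    proof (rule integral_dominated_convergence[OF _ _ w])
      show "AE t in M. (\<lambda>i. (k (X i) t - k x t) / (X i - x)) \<longlonglongrightarrow> k' x t"
      proof (rule AE_I2)
        fix t
        have "((\<lambda>y. (k y t - k x t) / (y - x)) \<longlongrightarrow> k' x t) (at x)"
          using deriv[OF x] by (simp add: has_field_derivative_iff)
        then show "(\<lambda>i. (k (X i) t - k x t) / (X i - x)) \<longlonglongrightarrow> k' x t"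
          using X' lim unfolding tendsto_at_iff_sequentially comp_def by auto
      qed
      show "AE t in M. norm ((k (X i) t - k x t) / (X i - x)) \<le> w t" for i
      proof (rule AE_I2)
        fix t
        have "norm (k (X i) t - k x t) \<le> w t * norm (X i - x)"
        proof (rule field_differentiable_bound[of "ball x d"])
          fix y assume "y \<in> ball x d"
          then have y: "\<bar>y - x\<bar> < d"
            by (simp add: dist_real_def abs_minus_commute)
          show "((\<lambda>y. k y t) has_field_derivative k' y t) (at y within ball x d)"
            using deriv[OF y] by (rule has_field_derivative_at_within)
          show "norm (k' y t) \<le> w t"
            using bound[OF y] by simp
        qed (use X' \<open>d > 0\<close> in \<open>auto simp: dist_real_def abs_minus_commute\<close>)
        then show "norm ((k (X i) t - k x t) / (X i - x)) \<le> w t"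
          using X'(2)[of i] by (simp add: pos_divide_le_eq)
      qed
    qed auto
    moreover have "(LINT t|M. (k (X i) t - k x t) / (X i - x)) = ((LINT t|M. k (X i) t) - (LINT t|M. k x t)) / (X i - x)" for i
      using k[OF X'(1)[of i]] k[OF x] by simp
    ultimately show "(\<lambda>i. ((LINT t|M. k (X i) t) - (LINT t|M. k x t)) / (X i - x)) \<longlonglongrightarrow> (LINT t|M. k' x t)"
      by (simp only:)
  qed
  then show ?thesis
    using \<open>d > 0\<close> by (simp add: has_field_derivative_iff at_within_open[of x "ball x d"])
qed

section \<open>Derivatives of the Stieltjes transform\<close>

locale stieltjes_measure =
  fixes \<rho> :: "real measure" and lam :: real
  assumes lam_pos: "lam > 0"
    and sets_eq_borel [simp, measurable_cong]: "sets \<rho> = sets borel"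
    and integrable_kernel: "\<And>x. x > 0 \<Longrightarrow> set_integrable \<rho> {0..} (\<lambda>t. 1 / (x + t) powr lam)"
begin

text \<open>For \<open>t \<ge> 0\<close> the extra factor \<open>1 / (x + t) ^ n\<close> is at most
  the constant \<open>1 / x ^ n\<close>.\<close>

lemma integrable_kernel_shift:
  assumes "x > 0"
  shows "set_integrable \<rho> {0..} (\<lambda>t. 1 / (x + t) powr (lam + real n))"
proof -
  have "set_integrable \<rho> {0..} (\<lambda>t. 1 / x ^ n * (1 / (x + t) powr lam))"
    using integrable_kernel[OF assms] by (rule set_integrable_mult_right)
  then show ?thesis
  proof (rule set_integrable_bound)
    show "set_borel_measurable \<rho> {0..} (\<lambda>t. 1 / (x + t) powr (lam + real n))"
      unfolding set_borel_measurable_def by measurable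
    show "AE t in \<rho>. t \<in> {0..} \<longrightarrow> norm (1 / (x + t) powr (lam + real n)) \<le> norm (1 / x ^ n * (1 / (x + t) powr lam))"
    proof (intro AE_I2 impI)
      fix t :: real assume "t \<in> {0..}"
      then have t: "t \<ge> 0" "x + t > 0"
        using assms by auto
      then have "x ^ n * (x + t) powr lam \<le> (x + t) ^ n * (x + t) powr lam"
        using assms by (intro mult_right_mono power_mono) auto
      also have "\<dots> = (x + t) powr (lam + real n)"
        using t by (simp add: powr_add powr_realpow)
      finally show "norm (1 / (x + t) powr (lam + real n)) \<le> norm (1 / x ^ n * (1 / (x + t) powr lam))"
        using assms t by (simp add: frac_le)
    qed
  qed
qed

text \<open>For \<open>n > 0\<close> this is the \<open>n\<close>-th derivative of the transform
  divided by \<open>(-1) ^ n * pochhammer lam n\<close>.\<close>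

definition stieltjes_integral :: "nat \<Rightarrow> real \<Rightarrow> real" where
  "stieltjes_integral n x = (LINT t:{0..}|\<rho>. 1 / (x + t) powr (lam + real n))"

lemma stieltjes_integral_has_derivative:
  assumes "x > 0"
  shows "(stieltjes_integral n has_real_derivative - (lam + real n) * stieltjes_integral (Suc n) x) (at x)"
proof -
  define s where "s = lam + real n"
  have s: "s > 0"
    using lam_pos by (simp add: s_def)
  have "((\<lambda>y. LINT t|\<rho>. indicator {0..} t *\<^sub>R (1 / (y + t) powr s)) has_real_derivative
      (LINT t|\<rho>. indicator {0..} t *\<^sub>R (- s * (1 / (x + t) powr (s + 1))))) (at x)"
  proof (rule has_real_derivative_integral)
    \<comment> \<open>Radius \<open>x / 2\<close> keeps \<open>y\<close> above \<open>x / 2\<close>,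
      so the kernel at \<open>x / 2\<close> dominates uniformly in \<open>y\<close>.\<close>
    show "x / 2 > 0"
      using assms by simp
    fix y assume "\<bar>y - x\<bar> < x / 2"
    then have y: "y > x / 2"
      by arith
    show "((\<lambda>y. indicator {0..} t *\<^sub>R (1 / (y + t) powr s)) has_real_derivative
        indicator {0..} t *\<^sub>R (- s * (1 / (y + t) powr (s + 1)))) (at y)" for t
    proof (cases "t \<ge> 0")
      case True
      then have "y + t > 0"
        using y assms by simp
      then have "((\<lambda>y. (y + t) powr (- s)) has_real_derivative - s * (y + t) powr (- s - 1)) (at y)"
        by (auto intro!: derivative_eq_intros simp: powr_diff)
      moreover have "- s - 1 = - (s + 1)"
        by simp
      ultimately show ?thesis
        using True by (simp only: powr_minus_divide) simp
    qed simp
    show "\<bar>indicator {0..} t *\<^sub>R (- s * (1 / (y + t) powr (s + 1)))\<bar>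
        \<le> indicator {0..} t *\<^sub>R (s * (1 / (x / 2 + t) powr (s + 1)))" for t
      using y assms s by (auto simp: indicator_def abs_mult intro!: divide_left_mono powr_mono2 mult_pos_pos)
    show "integrable \<rho> (\<lambda>t. indicator {0..} t *\<^sub>R (1 / (y + t) powr s))"
      using integrable_kernel_shift[of y n] y assms by (simp add: set_integrable_def s_def)
  next
    show "integrable \<rho> (\<lambda>t. indicator {0..} t *\<^sub>R (s * (1 / (x / 2 + t) powr (s + 1))))"
      using set_integrable_mult_right[OF integrable_kernel_shift[of "x / 2" "Suc n"], of s] assms
      by (simp add: set_integrable_def s_def add_ac)
    show "(\<lambda>t. indicator {0..} t *\<^sub>R (- s * (1 / (x + t) powr (s + 1)))) \<in> borel_measurable \<rho>"
      by measurable
  qed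
  then show ?thesis
    unfolding set_lebesgue_integral_def[symmetric] set_integral_mult_right
    by (simp add: stieltjes_integral_def[abs_def] s_def add_ac)
qed

lemma stieltjes_transform_deriv:
  assumes f: "\<And>x. x > 0 \<Longrightarrow> f x = C + (LINT t:{0..}|\<rho>. 1 / (x + t) powr lam)"
  shows "smooth_pos f"
    and "x > 0 \<Longrightarrow> (deriv ^^ n) f x = (if n = 0 then C else 0) + (-1) ^ n * pochhammer lam n * stieltjes_integral n x"
proof -
  \<comment> \<open>Each differentiation contributes the factor \<open>- (lam + real n)\<close>,
    which extends the Pochhammer symbol by one factor.\<close>
  define D where "D n x = (if n = 0 then C else 0) + (-1) ^ n * pochhammer lam n * stieltjes_integral n x" for n x
  have D: "(D n has_real_derivative D (Suc n) x) (at x)" if "x > 0" for n x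
    unfolding D_def[abs_def]
    by (rule derivative_eq_intros stieltjes_integral_has_derivative[OF that] refl)+
      (simp add: pochhammer_rec' algebra_simps)
  have f0: "f x = D 0 x" if "x > 0" for x
    using f[OF that] by (simp add: D_def stieltjes_integral_def)
  show "smooth_pos f"
    by (rule smooth_posI[of D, OF D f0])
  show "x > 0 \<Longrightarrow> (deriv ^^ n) f x = (if n = 0 then C else 0) + (-1) ^ n * pochhammer lam n * stieltjes_integral n x"
    using smooth_posI(2)[of D, OF D f0] by (simp add: D_def)
qed

text \<open>Under the integral the binomial theorem gives
  \<open>(1 - x / (x + t)) ^ k / (x + t) powr (lam + real n)\<close>, and
  \<open>1 - x / (x + t) = t / (x + t)\<close> is nonnegative for \<open>t \<ge> 0\<close>.\<close>

lemma sum_stieltjes_integral_nonneg: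
  assumes "x > 0"
  shows "(\<Sum>j\<le>k. real (k choose j) * (- x) ^ j * stieltjes_integral (n + j) x) \<ge> 0"
proof -
  have "(\<Sum>j\<le>k. real (k choose j) * (- x) ^ j * stieltjes_integral (n + j) x)
      = (\<Sum>j\<le>k. LINT t|\<rho>. real (k choose j) * (- x) ^ j *
          (indicator {0..} t *\<^sub>R (1 / (x + t) powr (lam + real (n + j)))))"
    unfolding stieltjes_integral_def set_lebesgue_integral_def by (simp only: integral_mult_right_zero)
  also have "\<dots> = (LINT t|\<rho>. (\<Sum>j\<le>k. real (k choose j) * (- x) ^ j *
          (indicator {0..} t *\<^sub>R (1 / (x + t) powr (lam + real (n + j))))))"
    by (rule Bochner_Integration.integral_sum[symmetric], rule integrable_mult_right,
      rule integrable_kernel_shift[OF assms, unfolded set_integrable_def])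
  also have "\<dots> \<ge> 0"
  proof (rule integral_nonneg_AE, rule AE_I2)
    fix t
    show "0 \<le> (\<Sum>j\<le>k. real (k choose j) * (- x) ^ j *
          (indicator {0..} t *\<^sub>R (1 / (x + t) powr (lam + real (n + j)))))"
    proof (cases "t \<ge> 0")
      case True
      then have pos: "x + t > 0"
        using assms by simp
      have "(\<Sum>j\<le>k. real (k choose j) * (- x) ^ j * (1 / (x + t) powr (lam + real (n + j))))
          = (\<Sum>j\<le>k. real (k choose j) * (- x / (x + t)) ^ j * 1 ^ (k - j)) / (x + t) powr (lam + real n)"
        using pos by (simp add: sum_divide_distrib powr_add powr_realpow power_divide mult_ac del: divide_minus_left)
      also have "\<dots> = (- x / (x + t) + 1) ^ k / (x + t) powr (lam + real n)"
        by (simp only: binomial_ring)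
      also have "- x / (x + t) + 1 = t / (x + t)"
        using pos by (simp add: field_simps)
      finally show ?thesis
        using True pos by simp
    qed simp
  qed
  finally show ?thesis .
qed

end

text \<open>The Gamma quotients cancel the Pochhammer symbols of the derivatives, leaving a common
  factor \<open>A\<close> times the sum just treated. The constant \<open>C\<close> contributes only
  to the term with \<open>n = j = 0\<close>.\<close>

lemma F_lam_stieltjes_nonneg:
  assumes "stieltjes_measure \<rho> lam" "C \<ge> 0" "x > 0"
    and f: "\<And>x. x > 0 \<Longrightarrow> f x = C + (LINT t:{0..}|\<rho>. 1 / (x + t) powr lam)"
  shows "F_lam lam f n k x \<ge> 0"
proof -
  interpret stieltjes_measure \<rho> lam by fact
  have Gamma_pos: "Gamma (real i + lam) > 0" for i
    using lam_pos by (intro Gamma_real_pos) simp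
  have poch: "pochhammer lam i = Gamma (real i + lam) / Gamma lam" for i
    using lam_pos pochhammer_Gamma[of lam i] by (auto simp: nonpos_Ints_def add_ac)
  define A where "A = Gamma (real (n + k) + lam) / Gamma lam"
  have A: "A > 0"
    using Gamma_pos[of "n + k"] Gamma_pos[of 0] by (simp add: A_def)
  have df: "(deriv ^^ i) f x = (if i = 0 then C else 0) + (-1) ^ i * (Gamma (real i + lam) / Gamma lam) * stieltjes_integral i x" for i
    using stieltjes_transform_deriv(2)[of f C x i, OF f \<open>x > 0\<close>] by (simp only: poch)
  have eq: "(-1) ^ n * (real (k choose j) * (Gamma (real (n + k) + lam) / Gamma (real (n + j) + lam)) * x ^ j * (deriv ^^ (n + j)) f x)
      = (if n + j = 0 then A * C else 0) + A * (real (k choose j) * (- x) ^ j * stieltjes_integral (n + j) x)" for j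
    using Gamma_pos[of "n + j"] Gamma_pos[of 0]
    unfolding df A_def by (simp add: power_minus[of x] power_add field_simps)
  have "F_lam lam f n k x = (\<Sum>j\<le>k. (if n + j = 0 then A * C else 0)) +
      A * (\<Sum>j\<le>k. real (k choose j) * (- x) ^ j * stieltjes_integral (n + j) x)"
    unfolding F_lam_def sum_distrib_left eq by (simp add: sum.distrib atLeast0AtMost)
  then show ?thesis
    using A \<open>C \<ge> 0\<close> sum_stieltjes_integral_nonneg[OF \<open>x > 0\<close>, of k n]
    by (auto intro!: add_nonneg_nonneg sum_nonneg)
qed

section \<open>The characterization\<close>

text \<open>The measure \<open>\<rho>\<close> is the image of a weighted \<open>\<nu>\<close> under
  \<open>t = (1 - r) / r\<close>, which maps \<open>{0<..1}\<close> onto \<open>{0..}\<close>; at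
  \<open>x = 1\<close> the transported kernel is the plain power \<open>r ^ n\<close>.\<close>

lemma stieltjes_measure_of_unit_interval:
  fixes \<nu> :: "real measure"
  assumes "lam > 0" and fin: "finite_measure \<nu>" and sets [simp, measurable_cong]: "sets \<nu> = sets borel"
  obtains \<rho> where "stieltjes_measure \<rho> lam" "emeasure \<rho> {..<0} = 0"
    "\<And>n. (LINT t:{0..}|\<rho>. 1 / (1 + t) powr (lam + real n)) = (LINT r|\<nu>. indicator {0<..1} r * r ^ n)"
proof -
  interpret finite_measure \<nu> by fact
  \<comment> \<open>The factor \<open>r powr (- lam)\<close> cancels the \<open>r powr lam\<close>
    that the kernel acquires from \<open>x + T r = (x * r + (1 - r)) / r\<close>. The indicator
    drops the mass at 0, where \<open>T 0 = 0\<close> only by the convention for division by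
    zero.\<close>
  define w where "w r = indicator {0<..1} r * r powr (- lam)" for r :: real
  define T where "T r = (1 - r) / r" for r :: real
  have [measurable]: "w \<in> borel_measurable borel" "T \<in> borel_measurable borel"
    unfolding w_def[abs_def] T_def[abs_def] by measurable
  have w_nonneg: "w r \<ge> 0" for r
    by (simp add: w_def)
  define \<rho> where "\<rho> = distr (density \<nu> w) borel T"
  have kernel: "w r *\<^sub>R (indicator {0..} (T r) *\<^sub>R (1 / (x + T r) powr (lam + real n)))
      = indicator {0<..1} r * r ^ n / (x * r + (1 - r)) powr (lam + real n)" if "x > 0" for x r :: real and n
  proof (cases "r \<in> {0<..1}")
    case True
    then have r: "r > 0" "r \<le> 1"
      by auto
    have "x * r > 0"
      using that r by simp
    then have "x * r + (1 - r) > 0"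
      using r by linarith
    moreover have "x + T r = (x * r + (1 - r)) / r"
      using r by (simp add: T_def field_simps)
    ultimately have "(x + T r) powr (lam + real n) = (x * r + (1 - r)) powr (lam + real n) / (r powr lam * r ^ n)"
      using r by (simp add: powr_divide powr_add powr_realpow)
    then show ?thesis
      using True r by (simp add: w_def T_def powr_minus_divide)
  qed (auto simp: w_def)
  have "set_integrable \<rho> {0..} (\<lambda>t. 1 / (x + t) powr lam)" if "x > 0" for x
  proof -
    have "integrable \<nu> (\<lambda>r. indicator {0<..1} r / (x * r + (1 - r)) powr lam)"
    \<comment> \<open>For \<open>r\<close> in \<open>{0<..1}\<close> the base
      \<open>x * r + (1 - r)\<close> is a convex combination of \<open>x\<close> and 1, hence at
      least \<open>min x 1\<close>.\<close>
    proof (rule integrable_const_bound[of _ "1 / min x 1 powr lam"], rule AE_I2)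
      fix r :: real
      show "norm (indicator {0<..1} r / (x * r + (1 - r)) powr lam) \<le> 1 / min x 1 powr lam"
      proof (cases "r \<in> {0<..1}")
        case True
        then have "min x 1 * r + min x 1 * (1 - r) \<le> x * r + 1 * (1 - r)"
          by (intro add_mono mult_right_mono) auto
        then have "min x 1 \<le> x * r + (1 - r)"
          by (simp add: algebra_simps)
        moreover have "0 < min x 1"
          using that by simp
        ultimately have "min x 1 powr lam \<le> (x * r + (1 - r)) powr lam" "0 < min x 1 powr lam"
          using \<open>lam > 0\<close> by (auto intro!: powr_mono2)
        then show ?thesis
          using True by (simp add: frac_le)
      qed simp
    qed measurable
    then have "integrable (density \<nu> w) (\<lambda>r. indicator {0..} (T r) *\<^sub>R (1 / (x + T r) powr lam))"
      using kernel[OF that, of _ 0] w_nonneg by (subst integrable_density) auto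
    then show ?thesis
      unfolding set_integrable_def \<rho>_def by (subst integrable_distr_eq) auto
  qed
  then have "stieltjes_measure \<rho> lam"
    using \<open>lam > 0\<close> by unfold_locales (auto simp: \<rho>_def)
  moreover have "emeasure \<rho> {..<0} = 0"
  proof -
    have "emeasure \<rho> {..<0} = emeasure (density \<nu> w) (T -` {..<0})"
      unfolding \<rho>_def by (subst emeasure_distr) (auto simp: sets_eq_imp_space_eq[OF sets])
    also have "\<dots> = (\<integral>\<^sup>+r. ennreal (w r) * indicator (T -` {..<0}) r \<partial>\<nu>)"
      using measurable_sets_borel[of T borel "{..<0}"] by (intro emeasure_density) auto
    \<comment> \<open>\<open>T r < 0\<close> forces \<open>r < 0\<close> or \<open>r > 1\<close>,
      where the weight vanishes.\<close>
    also have "(\<lambda>r. ennreal (w r) * indicator (T -` {..<0}) r) = (\<lambda>_. 0)"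
      by (auto simp: fun_eq_iff w_def T_def indicator_def divide_less_0_iff)
    finally show ?thesis
      by simp
  qed
  moreover have "(LINT t:{0..}|\<rho>. 1 / (1 + t) powr (lam + real n)) = (LINT r|\<nu>. indicator {0<..1} r * r ^ n)" for n
  proof -
    have "(LINT t:{0..}|\<rho>. 1 / (1 + t) powr (lam + real n))
        = (LINT r|density \<nu> w. indicator {0..} (T r) *\<^sub>R (1 / (1 + T r) powr (lam + real n)))"
      unfolding set_lebesgue_integral_def \<rho>_def by (subst integral_distr) auto
    also have "\<dots> = (LINT r|\<nu>. w r *\<^sub>R (indicator {0..} (T r) *\<^sub>R (1 / (1 + T r) powr (lam + real n))))"
      using w_nonneg by (subst integral_density) auto
    also have "\<dots> = (LINT r|\<nu>. indicator {0<..1} r * r ^ n)"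
      by (simp only: kernel[OF zero_less_one]) simp
    finally show ?thesis .
  qed
  ultimately show thesis
    using that by blast
qed

section \<open>From the sign conditions to the representing measure\<close>

text \<open>The case \<open>k = 0\<close> of the sign conditions is thus complete
  monotonicity.\<close>

lemma F_lam_0:
  assumes "lam > 0"
  shows "F_lam lam f n 0 x = (-1) ^ n * (deriv ^^ n) f x"
proof -
  have "Gamma (real n + lam) > 0"
    using assms by (intro Gamma_real_pos) simp
  then show ?thesis
    by (simp add: F_lam_def)
qed

text \<open>With the Pochhammer symbols written as Gamma quotients, both sums carry the same
  coefficients up to a factor independent of \<open>j\<close>, and the signs \<open>(-1) ^ j\<close>
  and \<open>(-1) ^ (n + j)\<close> combine to \<open>(-1) ^ n\<close>.\<close>

lemma moment_diff_Taylor_coeffs: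
  assumes "lam > 0"
  shows "moment_diff (\<lambda>n. (-1) ^ n * (deriv ^^ n) f 1 / pochhammer lam n) k n
    = Gamma lam / Gamma (real (n + k) + lam) * F_lam lam f n k 1"
proof -
  have Gamma_pos: "Gamma (real i + lam) > 0" for i
    using assms by (intro Gamma_real_pos) simp
  have poch: "pochhammer lam i = Gamma (real i + lam) / Gamma lam" for i
    using assms pochhammer_Gamma[of lam i] by (auto simp: nonpos_Ints_def add_ac)
  have "(-1) ^ j * real (k choose j) * ((-1) ^ (n + j) * (deriv ^^ (n + j)) f 1 / pochhammer lam (n + j))
      = Gamma lam / Gamma (real (n + k) + lam) * ((-1) ^ n * (real (k choose j) *
        (Gamma (real (n + k) + lam) / Gamma (real (n + j) + lam)) * 1 ^ j * (deriv ^^ (n + j)) f 1))" for j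
    using Gamma_pos[of "n + k"] Gamma_pos[of "n + j"] by (simp add: poch power_add field_simps)
  then show ?thesis
    unfolding moment_diff_eq_sum F_lam_def sum_distrib_left atLeast0AtMost by (intro sum.cong) auto
qed

lemma gen_stieltjesI:
  assumes "lam > 0" and smooth: "smooth_pos f" and nonneg: "\<And>n k x. x > 0 \<Longrightarrow> F_lam lam f n k x \<ge> 0"
  shows "gen_stieltjes lam f"
proof -
  \<comment> \<open>Dividing by the Pochhammer symbol undoes the factor produced by differentiating
    the kernel, so that these numbers can be pure moments.\<close>
  define m where "m n = (-1) ^ n * (deriv ^^ n) f 1 / pochhammer lam n" for n
  have poch_pos: "pochhammer lam n > 0" for n
    using \<open>lam > 0\<close> by (rule pochhammer_pos)
  have "moment_diff m k n \<ge> 0" for k n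
  proof -
    have "Gamma lam > 0" "Gamma (real (n + k) + lam) > 0"
      using \<open>lam > 0\<close> by auto
    then show ?thesis
      unfolding m_def[abs_def] moment_diff_Taylor_coeffs[OF \<open>lam > 0\<close>] using nonneg[of 1 n k] by simp
  qed
  then obtain \<nu> where sets: "sets \<nu> = sets borel" and fin: "finite_measure \<nu>"
      and unit: "AE r in \<nu>. r \<in> {0..1}" and moment: "\<And>n. (LINT r|\<nu>. r ^ n) = m n"
    using hausdorff_moment by blast
  note [measurable_cong] = sets
  interpret \<nu>: finite_measure \<nu> by fact
  obtain \<rho> where \<rho>: "stieltjes_measure \<rho> lam" "emeasure \<rho> {..<0} = 0"
      and integral_1: "\<And>n. (LINT t:{0..}|\<rho>. 1 / (1 + t) powr (lam + real n)) = (LINT r|\<nu>. indicator {0<..1} r * r ^ n)"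
    using stieltjes_measure_of_unit_interval[OF \<open>lam > 0\<close> fin sets] by blast
  interpret stieltjes_measure \<rho> lam by fact
  \<comment> \<open>Under \<open>t = (1 - r) / r\<close> the point \<open>r = 0\<close> goes to infinity, so its mass becomes the constant.\<close>
  define C where "C = m 0 - stieltjes_integral 0 1"
  have int_01: "integrable \<nu> (indicat_real {0<..1})"
    by (rule \<nu>.integrable_const_bound[of _ 1]) auto
  \<comment> \<open>\<open>C\<close> is the total mass of \<open>\<nu>\<close> minus its mass on
    \<open>{0<..1}\<close>.\<close>
  have "(LINT r|\<nu>. indicat_real {0<..1} r) \<le> (LINT r|\<nu>. 1)"
    by (rule integral_mono[OF int_01]) auto
  then have "C \<ge> 0"
    using moment[of 0] integral_1[of 0] by (simp add: C_def stieltjes_integral_def)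
  have integral_m: "stieltjes_integral n 1 = m n" if "n > 0" for n
  proof -
    have "stieltjes_integral n 1 = (LINT r|\<nu>. indicator {0<..1} r * r ^ n)"
      by (simp add: stieltjes_integral_def integral_1)
    also have "\<dots> = (LINT r|\<nu>. r ^ n)"
    \<comment> \<open>For \<open>n > 0\<close> the power vanishes at \<open>r = 0\<close>, so the
      dropped atom matters only to the moment of order 0.\<close>
    proof (rule integral_cong_AE)
      show "AE r in \<nu>. indicator {0<..1} r * r ^ n = r ^ n"
        using unit by eventually_elim (use that in \<open>auto simp: indicator_def zero_power\<close>)
    qed measurable
    finally show ?thesis
      by (simp add: moment)
  qed
  define g where "g x = C + (LINT t:{0..}|\<rho>. 1 / (x + t) powr lam)" for x
  have cm_f: "completely_monotone f"
    using smooth nonneg[of _ _ 0] unfolding completely_monotone_def by (simp add: F_lam_0[OF \<open>lam > 0\<close>])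
  have cm_g: "completely_monotone g"
    using stieltjes_transform_deriv(1)[OF g_def] F_lam_stieltjes_nonneg[OF \<rho>(1) \<open>C \<ge> 0\<close> _ g_def, of _ _ 0]
    unfolding completely_monotone_def by (simp add: F_lam_0[OF \<open>lam > 0\<close>])
  have "(deriv ^^ n) f 1 = (deriv ^^ n) g 1" for n
  proof -
    \<comment> \<open>In order 0 the constant restores the missing mass:
      \<open>C + stieltjes_integral 0 1 = m 0\<close>.\<close>
    have "(deriv ^^ n) g 1 = (-1) ^ n * pochhammer lam n * m n"
      using stieltjes_transform_deriv(2)[OF g_def, of 1 n] integral_m[of n]
      by (cases "n = 0") (simp_all add: C_def)
    also have "\<dots> = (deriv ^^ n) f 1"
      using poch_pos[of n] by (simp add: m_def)
    finally show ?thesis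
      by simp
  qed
  then have "f x = g x" if "x > 0" for x
    using completely_monotone_eqI[OF cm_f cm_g zero_less_one _ that] by blast
  then show ?thesis
    unfolding gen_stieltjes_def using \<open>C \<ge> 0\<close> \<rho>(2) integrable_kernel
    by (intro exI[of _ C] exI[of _ \<rho>]) (auto simp: g_def)
qed

theorem theorem2:
  fixes lam :: real and f :: "real \<Rightarrow> real"
  assumes "lam > 0"
  shows "gen_stieltjes lam f \<longleftrightarrow>
           (smooth_pos f \<and> (\<forall>n k. \<forall>x>0. F_lam lam f n k x \<ge> 0))"
proof
  assume "gen_stieltjes lam f"
  then obtain C \<rho> where C: "C \<ge> 0" and sets: "sets \<rho> = sets borel"
    and int: "\<And>x. x > 0 \<Longrightarrow> set_integrable \<rho> {0..} (\<lambda>t. 1 / (x + t) powr lam)"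
    and f: "\<And>x. x > 0 \<Longrightarrow> f x = C + (LINT t:{0..}|\<rho>. 1 / (x + t) powr lam)"
    unfolding gen_stieltjes_def by blast
  have \<rho>: "stieltjes_measure \<rho> lam"
    using assms sets int by unfold_locales
  show "smooth_pos f \<and> (\<forall>n k. \<forall>x>0. F_lam lam f n k x \<ge> 0)"
    using stieltjes_measure.stieltjes_transform_deriv(1)[OF \<rho> f] F_lam_stieltjes_nonneg[OF \<rho> C _ f] by blast
qed (use gen_stieltjesI assms in blast)

end
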